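(* Let $\Omega$, $p,q$, $k_0$, $k_\star$, $\mathcal{V}_0$, $\mathcal{V}_\star$, and $\mathcal{V}=\mathcal{V}_0+\mathcal{V}_\star$ be as in the context. Suppose that there are real constants $\tau>0$, $\gamma>0$, $\lambda_\Delta$ and a constant $M$ such that: (i) $k_0(a,a)-\tau/a$ is bounded on a neighborhood of $0$ in $\Omega$, and for each $\sigma>\tau$ there is a neighborhood of $(0,0)$ in $\Omega^2$ on which $|k_0(a,a')|<\sigma/|a|$; (ii) $|k_0(a,a')|\le \dfrac{M}{|a|}\,e^{\lambda_\Delta|a-a'|}$ for all $a,a'\in\Omega$; (iii) $|k_\star(a,a')|\le M\,\dfrac{|a-a'|^\gamma}{|a|}\,e^{\lambda_\Delta|a-a'|}$ for all $a,a'\in\Omega$. Let $\rho>\tau$ and let $g\in\mathcal{H}L^\infty_{\rho-1,\bullet}(\Omega)$. Then the inhomogeneous equation $$f=\mathcal{V}f+g$$ has a unique solution $f$ in the space $\mathcal{H}L^\infty_{\rho-1,\bullet}(\Omega)$.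
   Context: $\Omega\subset\mathbb{C}$ is a simply connected open set with $0\notin\Omega$ and $0\in\overline{\Omega}$, star-shaped around $0$: for every $a\in\Omega$ the segment $\{ta: 0<t\le 1\}$ lies in $\Omega$. $\mathcal{H}(\Omega)$ is the space of holomorphic functions on $\Omega$. The functions $p,q\in\mathcal{H}(\Omega)$ are such that $k_0(a,a')=-q(a')/p(a)$ is holomorphic on $\Omega^2$ (so $p$ has no zeros in $\Omega$ when $q\not\equiv0$), and $k_\star$ is a holomorphic function on $\Omega^2$. The Volterra operators are $[\mathcal{V}_0\varphi](a)=\int_0^a k_0(a,a')\varphi(a')\,da'$ and $[\mathcal{V}_\star\varphi](a)=\int_0^a k_\star(a,a')\varphi(a')\,da'$. Integrals $\int_0^a$ are (possibly improper at $0$) integrals along the straight segment from $0$ to $a$. A neighborhood of $0$ in $\Omega$ means $U\cap\Omega$ with $U\subset\mathbb{C}$ an open neighborhood of $0$, and similarly a neighborhood of $(0,0)$ in $\Omega^2$ means $U\cap\Omega^2$ with $U\subset\mathbb{C}^2$ an open neighborhood of $(0,0)$. For $\sigma,\Lambda\in\mathbb{R}$, $\mathcal{H}L^\infty_{\sigma,\Lambda}(\Omega)$ is the space of $f\in\mathcal{H}(\Omega)$ with $\|f\|_{\sigma,\Lambda}:=\sup_{a\in\Omega}|a|^{-\sigma}e^{-\Lambda|a|}|f(a)|<\infty$, and $\mathcal{H}L^\infty_{\sigma,\bullet}(\Omega)=\bigcup_{\Lambda\in\mathbb{R}}\mathcal{H}L^\infty_{\sigma,\Lambda}(\Omega)$.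 *)

theory Defs
  imports "HOL-Complex_Analysis.Complex_Analysis"
begin

definition star_shaped_0 :: "complex set \<Rightarrow> bool" where
  "star_shaped_0 \<Omega> \<longleftrightarrow> (\<forall>a\<in>\<Omega>. \<forall>t::real. 0 < t \<and> t \<le> 1 \<longrightarrow> of_real t * a \<in> \<Omega>)"

(* Holomorphy in two variables: at every point of the (open) set there is a Frechet derivative
   that is complex linear, which is why it is required to have the form (h, h') |-> u h + v h'. *)
definition holomorphic2_on :: "(complex \<times> complex \<Rightarrow> complex) \<Rightarrow> (complex \<times> complex) set \<Rightarrow> bool" where
  "holomorphic2_on k S \<longleftrightarrow>
     (\<forall>z\<in>S. \<exists>u v. (k has_derivative (\<lambda>h. u * fst h + v * snd h)) (at z within S))"

(* Requiring holomorphy of this kernel in both variables, together with its 1/a-like growth on the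
   diagonal at 0, rules out zeros of p: the convention x / 0 = 0 could only matter if p = 0 or
   q = 0 identically, where the kernel would vanish. *)
definition kernel0 :: "(complex \<Rightarrow> complex) \<Rightarrow> (complex \<Rightarrow> complex) \<Rightarrow> complex \<Rightarrow> complex \<Rightarrow> complex" where
  "kernel0 p q a a' = - q a' / p a"

(* Elements of the spaces below are total functions of which only the values on \<Omega> matter.
   Finiteness of the supremum norm is boundedness above of the weighted moduli. *)
definition HLinf :: "complex set \<Rightarrow> real \<Rightarrow> real \<Rightarrow> (complex \<Rightarrow> complex) set" where
  "HLinf \<Omega> \<sigma> \<Lambda> = {f. f holomorphic_on \<Omega> \<and>
     bdd_above ((\<lambda>a. cmod a powr (- \<sigma>) * exp (- \<Lambda> * cmod a) * cmod (f a)) ` \<Omega>)}"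

definition HLinf_bullet :: "complex set \<Rightarrow> real \<Rightarrow> (complex \<Rightarrow> complex) set" where
  "HLinf_bullet \<Omega> \<sigma> = (\<Union>\<Lambda>. HLinf \<Omega> \<sigma> \<Lambda>)"

(* Contour integrals are Henstock-Kurzweil integrals over the unit interval, so (by Hake's theorem)
   they include the integrals that are improper at the end point 0; the value of the integrand at
   the point 0 itself is irrelevant. *)
definition volterra :: "(complex \<Rightarrow> complex \<Rightarrow> complex) \<Rightarrow> (complex \<Rightarrow> complex) \<Rightarrow> complex \<Rightarrow> complex" where
  "volterra k \<phi> a = contour_integral (linepath 0 a) (\<lambda>a'. k a a' * \<phi> a')"

definition volterra_defined :: "(complex \<Rightarrow> complex \<Rightarrow> complex) \<Rightarrow> (complex \<Rightarrow> complex) \<Rightarrow> complex \<Rightarrow> bool" where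
  "volterra_defined k \<phi> a \<longleftrightarrow> (\<lambda>a'. k a a' * \<phi> a') contour_integrable_on (linepath 0 a)"

(* A solution of f = V f + g on \<Omega>, V being the sum of the Volterra operators with kernels k and k'.
   Existence of the integrals is part of the notion, because contour_integral has a
   default value where the integral does not exist. *)
definition volterra_solution ::
  "complex set \<Rightarrow> (complex \<Rightarrow> complex \<Rightarrow> complex) \<Rightarrow> (complex \<Rightarrow> complex \<Rightarrow> complex) \<Rightarrow>
    (complex \<Rightarrow> complex) \<Rightarrow> (complex \<Rightarrow> complex) \<Rightarrow> bool" where
  "volterra_solution \<Omega> k k' g f \<longleftrightarrow>
     (\<forall>a\<in>\<Omega>. volterra_defined k f a \<and> volterra_defined k' f a \<and>
        f a = (volterra k f a + volterra k' f a) + g a)"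

end

theory Submission
  imports Defs
begin

text \<open>
  Put \<open>w a = |a|^(\<rho> - 1) exp (L |a|)\<close>. For \<open>|\<phi>| \<le> C w\<close>, substituting \<open>a' = t a\<close> gives
  \<open>|V \<phi> a| \<le> C w a \<integral>\<^sub>0\<^sup>1 |k(a, t a)| |a| t^(\<rho> - 1) exp (- L (1 - t) |a|) dt\<close>.
  Near \<open>0\<close> the kernel \<open>k\<^sub>0\<close> contributes at most \<open>\<sigma> \<integral>\<^sub>0\<^sup>1 t^(\<rho> - 1) dt = \<sigma>/\<rho> < 1\<close> for any
  \<open>\<sigma>\<close> strictly between \<open>\<tau>\<close> and \<open>\<rho>\<close>. Away from \<open>0\<close> its contribution tends to \<open>0\<close> as \<open>L\<close> grows, by
  dominated convergence, and so does that of \<open>k\<^sub>\<star>\<close> everywhere, because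
  \<open>x^\<gamma> exp (- \<mu> x) \<le> (\<gamma>/\<mu>)^\<gamma>\<close>. Hence \<open>V\<close> is a contraction in the \<open>w\<close>-weighted supremum norm for every
  large \<open>L\<close>. The fixed point iteration converges locally uniformly, so the solution is holomorphic;
  two solutions of different exponential type are compared in a common larger \<open>L\<close>.
\<close>

section \<open>Holomorphic dependence of integrals on a parameter\<close>

text \<open>Around each point of the half ball a closed disc of radius \<open>r/4\<close> still lies
  in \<open>ball a r\<close>, so Cauchy's inequality bounds the derivative there by
  \<open>4 * B / r\<close>; convexity of the half ball turns this into a Lipschitz bound.\<close>

lemma deriv_bound_from_double_ball:
  assumes "f holomorphic_on ball a r" "r > 0" "\<And>z. z \<in> ball a r \<Longrightarrow> cmod (f z) \<le> B"
    and "y \<in> ball a (r/2)"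
  shows "cmod (f y - f a) \<le> 4 * B / r * cmod (y - a)"
proof (rule field_differentiable_bound[where S = "ball a (r/2)" and f' = "deriv f"])
  show "convex (ball a (r/2))" by simp
  show "y \<in> ball a (r/2)" by fact
  show "a \<in> ball a (r/2)" using assms by simp
  fix z assume z: "z \<in> ball a (r/2)"
  then have zr: "z \<in> ball a r" using \<open>r > 0\<close> by auto
  show "(f has_field_derivative deriv f z) (at z within ball a (r/2))"
    using holomorphic_derivI[OF assms(1) open_ball zr] has_field_derivative_at_within by blast
  have sub: "cball z (r/4) \<subseteq> ball a r"
  proof
    fix x assume "x \<in> cball z (r/4)"
    then show "x \<in> ball a r" using z dist_triangle[of a x z] \<open>r > 0\<close> by auto
  qed
  have "norm ((deriv ^^ 1) f z) \<le> fact 1 * B / (r/4) ^ 1"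
  proof (rule Cauchy_inequality)
    show "f holomorphic_on ball z (r/4)"
      using assms(1) sub ball_subset_cball holomorphic_on_subset by (metis subset_trans)
    show "continuous_on (cball z (r/4)) f"
      using assms(1) sub holomorphic_on_imp_continuous_on holomorphic_on_subset by blast
    show "0 < r/4" using assms by simp
    fix x assume "norm (z - x) = r/4"
    then have "x \<in> cball z (r/4)" by (simp add: dist_norm)
    then show "norm (f x) \<le> B" using sub assms(3) by blast
  qed
  then show "norm (deriv f z) \<le> 4 * B / r" by (simp add: field_simps)
qed

text \<open>Cauchy's inequality turns the bound on \<open>G\<close> into one on its difference quotients, so dominated
  convergence applies to them.\<close>

lemma holomorphic_on_dominated_integral:
  fixes G :: "complex \<Rightarrow> real \<Rightarrow> complex"
  assumes "open S"
    and hol: "\<And>t. t \<in> T \<Longrightarrow> (\<lambda>z. G z t) holomorphic_on S"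
    and int: "\<And>z. z \<in> S \<Longrightarrow> G z integrable_on T"
    and dom: "\<And>a. a \<in> S \<Longrightarrow> \<exists>r>0. \<exists>h. ball a r \<subseteq> S \<and> h integrable_on T \<and>
                 (\<forall>z\<in>ball a r. \<forall>t\<in>T. cmod (G z t) \<le> h t)"
  shows "(\<lambda>z. integral T (G z)) holomorphic_on S"
  unfolding holomorphic_on_open[OF \<open>open S\<close>]
proof
  fix a assume a: "a \<in> S"
  from dom[OF a] obtain r h where r: "r > 0" "ball a r \<subseteq> S" and h: "h integrable_on T"
    and all: "\<forall>z\<in>ball a r. \<forall>t\<in>T. cmod (G z t) \<le> h t"
    by metis
  have bd: "\<And>z t. z \<in> ball a r \<Longrightarrow> t \<in> T \<Longrightarrow> cmod (G z t) \<le> h t"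
    using all by blast
  let ?B = "ball a (r/2)"
  let ?D = "integral T (\<lambda>t. deriv (\<lambda>z. G z t) a)"
  \<comment> \<open>Taking the limit within the half ball keeps every sequence \<open>X\<close>
    where the Lipschitz bound for \<open>G\<close> applies.\<close>
  have aw: "at a within ?B = at a" by (rule at_within_open) (use r in auto)
  have "((\<lambda>y. (integral T (G y) - integral T (G a)) / (y - a)) \<longlongrightarrow> ?D) (at a within ?B)"
    unfolding tendsto_at_iff_sequentially
  proof (intro allI impI)
    fix X assume X: "\<forall>i. X i \<in> ?B - {a}" "X \<longlonglongrightarrow> a"
    have XS: "X i \<in> S" for i
    proof -
      have "X i \<in> ?B" using X by blast
      then have "X i \<in> ball a r" using r by auto
      then show ?thesis using r by blast
    qed
    have "(\<lambda>i. integral T (\<lambda>t. (G (X i) t - G a t) / (X i - a))) \<longlonglongrightarrow> ?D"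
    proof (rule dominated_convergence(2))
      show "(\<lambda>t. (G (X i) t - G a t) / (X i - a)) integrable_on T" for i
        by (intro integrable_on_divide integrable_diff int XS a)
      show "(\<lambda>t. 4 * h t / r) integrable_on T"
        using integrable_on_divide[OF integrable_on_cmult_left[OF h, of 4]] by simp
      fix t assume t: "t \<in> T"
      have holt: "(\<lambda>z. G z t) holomorphic_on ball a r"
        using hol[OF t] r holomorphic_on_subset by blast
      show "norm ((G (X i) t - G a t) / (X i - a)) \<le> 4 * h t / r" for i
      proof -
        have "cmod (G (X i) t - G a t) \<le> 4 * h t / r * cmod (X i - a)"
          using deriv_bound_from_double_ball[OF holt r(1) bd[OF _ t]] X(1) by blast
        moreover have "cmod (X i - a) > 0" using X(1) by simp
        ultimately show ?thesis by (simp add: norm_divide pos_divide_le_eq)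
      qed
      have "((\<lambda>z. G z t) has_field_derivative deriv (\<lambda>z. G z t) a) (at a)"
        using holomorphic_derivI[OF hol[OF t] \<open>open S\<close> a] .
      then have "((\<lambda>y. (G y t - G a t) / (y - a)) \<longlongrightarrow> deriv (\<lambda>z. G z t) a) (at a within ?B)"
        unfolding aw has_field_derivative_iff .
      then show "(\<lambda>i. (G (X i) t - G a t) / (X i - a)) \<longlonglongrightarrow> deriv (\<lambda>z. G z t) a"
        using X unfolding tendsto_at_iff_sequentially comp_def by blast
    qed
    moreover have "integral T (\<lambda>t. (G (X i) t - G a t) / (X i - a))
        = (integral T (G (X i)) - integral T (G a)) / (X i - a)" for i
      unfolding integral_diff[OF int[OF XS] int[OF a], symmetric] by (simp add: divide_inverse)
    ultimately show "((\<lambda>y. (integral T (G y) - integral T (G a)) / (y - a)) \<circ> X) \<longlonglongrightarrow> ?D"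
      by (simp only: comp_def)
  qed
  then show "\<exists>f'. ((\<lambda>z. integral T (G z)) has_field_derivative f') (at a)"
    unfolding aw has_field_derivative_iff by blast
qed

section \<open>Fixed points of contractions in weighted supremum norms\<close>

text \<open>Banach's iteration, carried out on explicit bounds: the increments of the iterates decay
  like \<open>\<theta> ^ n * w\<close>, and since \<open>w\<close> is locally bounded the
  telescoping series converges locally uniformly, which keeps the limit holomorphic. The contraction
  hypothesis speaks of any admissible constant \<open>C\<close>, so no norm has to be introduced.
  Uniqueness is left out because competing solutions may live in spaces with other weights.\<close>

lemma contraction_fixpoint_holomorphic:
  fixes S :: "complex set" and w :: "complex \<Rightarrow> real" and T :: "(complex \<Rightarrow> complex) \<Rightarrow> complex \<Rightarrow> complex"
  defines "E \<equiv> {\<phi>. \<phi> holomorphic_on S \<and> (\<exists>C. \<forall>a\<in>S. cmod (\<phi> a) \<le> C * w a)}"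
  assumes "open S" and w: "continuous_on S w" "\<And>a. a \<in> S \<Longrightarrow> w a \<ge> 0"
    and hol: "\<And>\<phi>. \<phi> \<in> E \<Longrightarrow> T \<phi> holomorphic_on S"
    and diff: "\<And>\<phi> \<psi> a. \<phi> \<in> E \<Longrightarrow> \<psi> \<in> E \<Longrightarrow> a \<in> S \<Longrightarrow> T (\<lambda>z. \<phi> z - \<psi> z) a = T \<phi> a - T \<psi> a"
    and contr: "\<And>\<phi> C a. \<phi> \<in> E \<Longrightarrow> \<forall>a\<in>S. cmod (\<phi> a) \<le> C * w a \<Longrightarrow> a \<in> S \<Longrightarrow>
                   cmod (T \<phi> a) \<le> \<theta> * C * w a"
    and \<theta>: "0 \<le> \<theta>" "\<theta> < 1"
    and g: "g \<in> E"
  shows "\<exists>f\<in>E. \<forall>a\<in>S. f a = T f a + g a"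
proof -
  have E_diff: "(\<lambda>z. \<phi> z - \<psi> z) \<in> E" if EE: "\<phi> \<in> E" "\<psi> \<in> E" for \<phi> \<psi>
  proof -
    obtain C D where "\<forall>a\<in>S. cmod (\<phi> a) \<le> C * w a" "\<forall>a\<in>S. cmod (\<psi> a) \<le> D * w a"
      using EE unfolding E_def by blast
    then have "\<forall>a\<in>S. cmod (\<phi> a - \<psi> a) \<le> (C + D) * w a"
      by (auto simp: distrib_right intro!: order_trans[OF norm_triangle_ineq4 add_mono])
    then show ?thesis using EE unfolding E_def by (auto intro: holomorphic_intros)
  qed
  have E_step: "(\<lambda>z. T \<phi> z + g z) \<in> E" if \<phi>: "\<phi> \<in> E" for \<phi>
  proof -
    obtain C D where C: "\<forall>a\<in>S. cmod (\<phi> a) \<le> C * w a" and D: "\<forall>a\<in>S. cmod (g a) \<le> D * w a"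
      using \<phi> g unfolding E_def by blast
    have "cmod (T \<phi> a + g a) \<le> (\<theta> * C + D) * w a" if "a \<in> S" for a
      using contr[OF \<phi> C that] D that norm_triangle_ineq[of "T \<phi> a" "g a"]
      by (auto simp: distrib_right intro: order_trans)
    moreover have "g holomorphic_on S" using g unfolding E_def by blast
    ultimately show ?thesis
      using hol[OF \<phi>] unfolding E_def by (auto intro!: holomorphic_intros)
  qed
  \<comment> \<open>Starting at the zero function makes \<open>F n\<close> equal to the sum of its
    first \<open>n\<close> increments, with no initial term.\<close>
  define F where "F = rec_nat (\<lambda>_. 0) (\<lambda>_ \<phi> z. T \<phi> z + g z)"
  have F0: "F 0 = (\<lambda>_. 0)" and FS: "F (Suc n) = (\<lambda>z. T (F n) z + g z)" for n
    unfolding F_def by simp_all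
  have FE: "F n \<in> E" for n
  proof (induction n)
    case 0
    show ?case unfolding E_def F0 by (auto simp: F0 intro!: exI[of _ 0])
  next
    case (Suc n) then show ?case unfolding FS by (rule E_step)
  qed
  obtain C0 where C0: "\<forall>a\<in>S. cmod (F 1 a - F 0 a) \<le> C0 * w a"
    using E_diff[OF FE FE, of 1 0] unfolding E_def by blast
  \<comment> \<open>\<open>C0\<close> can be negative if \<open>S\<close> is empty or
    \<open>w\<close> vanishes on \<open>S\<close>; later monotonicity steps need a nonnegative
    constant.\<close>
  define C where "C = max C0 0"
  have C: "\<forall>a\<in>S. cmod (F 1 a - F 0 a) \<le> C * w a" and "C \<ge> 0"
    using C0 w(2) unfolding C_def
    by (auto intro!: order_trans[OF _ mult_right_mono[of C0 "max C0 0"]])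
  have step: "\<forall>a\<in>S. cmod (F (Suc n) a - F n a) \<le> \<theta> ^ n * C * w a" for n
  proof (induction n)
    case 0 then show ?case using C by simp
  next
    case (Suc n)
    have "cmod (T (\<lambda>z. F (Suc n) z - F n z) a) \<le> \<theta> * (\<theta> ^ n * C) * w a" if "a \<in> S" for a
      by (rule contr[OF E_diff[OF FE FE] Suc that])
    moreover have "F (Suc (Suc n)) a - F (Suc n) a = T (F (Suc n)) a - T (F n) a" for a
      unfolding FS[of "Suc n"] by (simp add: FS[of n])
    ultimately show ?case using diff[OF FE FE] by (simp add: mult.assoc)
  qed
  define f where "f = (\<lambda>a. \<Sum>n. F (Suc n) a - F n a)"
  \<comment> \<open>A geometric series bounds the tail from \<open>n\<close> on. General
    \<open>n\<close> yields convergence, and \<open>n = 0\<close> yields membership of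
    \<open>f\<close> in \<open>E\<close>.\<close>
  have near: "cmod (f a - F n a) \<le> \<theta> ^ n * (C / (1 - \<theta>)) * w a" if a: "a \<in> S" for a n
  proof -
    have sg: "(\<lambda>i. \<theta> ^ i * (\<theta> ^ n * C * w a)) sums (1 / (1 - \<theta>) * (\<theta> ^ n * C * w a))"
      using \<theta> by (intro sums_mult2 geometric_sums) simp
    have bd: "cmod (F (Suc (i + n)) a - F (i + n) a) \<le> \<theta> ^ i * (\<theta> ^ n * C * w a)" for i
      using step[of "i + n"] a by (simp add: power_add mult_ac)
    have s: "summable (\<lambda>i. cmod (F (Suc (i + n)) a - F (i + n) a))"
      by (rule summable_comparison_test[OF _ sums_summable[OF sg]]) (use bd in auto)
    then have "summable (\<lambda>i. F (Suc (i + n)) a - F (i + n) a)"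
      by (rule summable_norm_cancel)
    then have sm: "summable (\<lambda>i. F (Suc i) a - F i a)"
      using summable_iff_shift[of "\<lambda>i. F (Suc i) a - F i a" n] by simp
    have "f a = (\<Sum>i. F (Suc (i + n)) a - F (i + n) a) + (\<Sum>i<n. F (Suc i) a - F i a)"
      unfolding f_def using suminf_split_initial_segment[OF sm, of n] by simp
    also have "(\<Sum>i<n. F (Suc i) a - F i a) = F n a"
      by (subst sum_lessThan_telescope) (simp add: F0)
    finally have "cmod (f a - F n a) \<le> (\<Sum>i. cmod (F (Suc (i + n)) a - F (i + n) a))"
      using summable_norm[OF s] by simp
    also have "\<dots> \<le> 1 / (1 - \<theta>) * (\<theta> ^ n * C * w a)"
      using suminf_le[OF bd s sums_summable[OF sg]] sums_unique[OF sg] by simp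
    finally show ?thesis by (simp add: mult_ac)
  qed
  let ?K = "C / (1 - \<theta>)"
  have K: "?K \<ge> 0" using \<open>C \<ge> 0\<close> \<theta> by simp
  have zero: "(\<lambda>n. \<theta> ^ n * c) \<longlonglongrightarrow> 0" for c
    using tendsto_mult_left_zero[OF LIMSEQ_realpow_zero[OF \<theta>]] .
  have "f holomorphic_on S"
  proof (rule holomorphic_uniform_sequence[OF \<open>open S\<close>, where f = F])
    show "F n holomorphic_on S" for n using FE unfolding E_def by blast
    fix x assume "x \<in> S"
    then obtain d where d: "d > 0" "cball x d \<subseteq> S" using \<open>open S\<close> open_contains_cball by blast
    \<comment> \<open>Boundedness of \<open>w\<close> on the closed disc makes the pointwise
      estimate \<open>near\<close> uniform there.\<close>
    have "compact (w ` cball x d)"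
      using w(1) d(2) continuous_on_subset compact_continuous_image compact_cball by blast
    then obtain B where B: "\<And>y. y \<in> cball x d \<Longrightarrow> w y \<le> B"
      using bounded_imp_bdd_above[OF compact_imp_bounded] unfolding bdd_above_def by (meson imageI)
    have "uniform_limit (cball x d) F f sequentially"
    proof (rule uniform_limitI)
      fix e :: real assume "e > 0"
      then have "\<forall>\<^sub>F n in sequentially. \<theta> ^ n * (?K * B) < e"
        using zero order_tendstoD(2) by blast
      then show "\<forall>\<^sub>F n in sequentially. \<forall>y\<in>cball x d. dist (F n y) (f y) < e"
      proof eventually_elim
        case (elim n)
        show ?case
        proof
          fix y assume y: "y \<in> cball x d"
          have "\<theta> ^ n * ?K * w y \<le> \<theta> ^ n * ?K * B"
            using B[OF y] K \<theta> by (intro mult_left_mono mult_nonneg_nonneg) auto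
          then have "cmod (f y - F n y) < e"
            using near[of y n] y d(2) elim by (auto simp: mult.assoc)
          then show "dist (F n y) (f y) < e" by (simp add: dist_norm norm_minus_commute)
        qed
      qed
    qed
    with d show "\<exists>d>0. cball x d \<subseteq> S \<and> uniform_limit (cball x d) F f sequentially" by blast
  qed
  moreover have "\<forall>a\<in>S. cmod (f a) \<le> ?K * w a" using near[of _ 0] by (simp add: F0)
  ultimately have fE: "f \<in> E" unfolding E_def by blast
  have "f a = T f a + g a" if a: "a \<in> S" for a
  proof -
    \<comment> \<open>Insert \<open>F (Suc n)\<close>: both \<open>f - F (Suc n)\<close> and
      \<open>T (F n) - T f\<close> are at most \<open>\<theta> ^ Suc n * ?K * w\<close>, whence the
      factor 2.\<close>
    have "cmod (f a - (T f a + g a)) \<le> \<theta> ^ n * (2 * \<theta> * ?K * w a)" for n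
    proof -
      have "\<forall>a\<in>S. cmod (F n a - f a) \<le> \<theta> ^ n * ?K * w a"
        using near by (simp add: norm_minus_commute)
      from contr[OF E_diff[OF FE fE] this a]
      have "cmod (T (F n) a - T f a) \<le> \<theta> * (\<theta> ^ n * ?K) * w a"
        by (simp add: diff[OF FE fE a])
      moreover have "cmod (f a - F (Suc n) a) \<le> \<theta> * (\<theta> ^ n * ?K) * w a"
        using near[OF a, of "Suc n"] by (simp add: mult_ac)
      moreover have "f a - (T f a + g a) = (f a - F (Suc n) a) + (T (F n) a - T f a)"
        by (simp add: FS)
      ultimately have "cmod (f a - (T f a + g a)) \<le> \<theta> * (\<theta> ^ n * ?K) * w a + \<theta> * (\<theta> ^ n * ?K) * w a"
        by (simp only: norm_triangle_mono)
      then show ?thesis by (simp add: mult_ac)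
    qed
    then have "\<exists>N. \<forall>n\<ge>N. cmod (f a - (T f a + g a)) \<le> \<theta> ^ n * (2 * \<theta> * ?K * w a)"
      by (intro exI allI impI)
    with zero have "cmod (f a - (T f a + g a)) \<le> 0" by (rule LIMSEQ_le_const)
    then show ?thesis by simp
  qed
  with fE show ?thesis by blast
qed

section \<open>Holomorphic functions of two variables\<close>

lemma holomorphic2_on_imp_continuous_on: "holomorphic2_on k S \<Longrightarrow> continuous_on S k"
  unfolding holomorphic2_on_def
  by (meson differentiable_def differentiable_imp_continuous_on differentiable_on_def)

text \<open>The chain rule: composing a complex linear derivative with two complex multiplications
  is again a complex multiplication. It is applied to \<open>z\<close> and
  \<open>of_real t * z\<close>, giving holomorphy of the kernel along a fixed fraction of the
  segment.\<close>

lemma holomorphic2_on_compose: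
  assumes k: "holomorphic2_on k S" and uv: "u holomorphic_on T" "v holomorphic_on T"
    and sub: "\<And>z. z \<in> T \<Longrightarrow> (u z, v z) \<in> S"
  shows "(\<lambda>z. k (u z, v z)) holomorphic_on T"
  unfolding holomorphic_on_def field_differentiable_def
proof
  fix z assume z: "z \<in> T"
  obtain \<alpha> \<beta> where "(k has_derivative (\<lambda>h. \<alpha> * fst h + \<beta> * snd h)) (at (u z, v z) within S)"
    using k sub[OF z] unfolding holomorphic2_on_def by metis
  then have dk: "(k has_derivative (\<lambda>h. \<alpha> * fst h + \<beta> * snd h))
      (at (u z, v z) within (\<lambda>z. (u z, v z)) ` T)"
    by (rule has_derivative_subset) (use sub in auto)
  obtain u' v' where "(u has_field_derivative u') (at z within T)" "(v has_field_derivative v') (at z within T)"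
    using uv z unfolding holomorphic_on_def field_differentiable_def by metis
  then have "((\<lambda>z. (u z, v z)) has_derivative (\<lambda>h. (u' * h, v' * h))) (at z within T)"
    unfolding has_field_derivative_def by (rule has_derivative_Pair)
  from has_derivative_in_compose[OF this dk]
  have "((\<lambda>z. k (u z, v z)) has_derivative (\<lambda>h. (\<alpha> * u' + \<beta> * v') * h)) (at z within T)"
    by (simp add: algebra_simps)
  then show "\<exists>f'. ((\<lambda>z. k (u z, v z)) has_field_derivative f') (at z within T)"
    unfolding has_field_derivative_def by blast
qed

section \<open>Volterra integrals over the unit interval\<close>

text \<open>At \<open>t = 0\<close> this involves the junk value \<open>\<phi> 0\<close>, so integrals are taken over the open unit
  interval.\<close>

definition volterra_integrand ::
  "(complex \<Rightarrow> complex \<Rightarrow> complex) \<Rightarrow> (complex \<Rightarrow> complex) \<Rightarrow> complex \<Rightarrow> real \<Rightarrow> complex" where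
  "volterra_integrand k \<phi> a t = k a (of_real t * a) * \<phi> (of_real t * a) * a"

text \<open>The path \<open>t * a\<close> has constant derivative \<open>a\<close>, the last factor
  of the integrand; dropping the two end points changes neither existence nor value of the
  integral.\<close>

lemma has_contour_integral_volterra_iff:
  "((\<lambda>a'. k a a' * \<phi> a') has_contour_integral I) (linepath 0 a)
     \<longleftrightarrow> (volterra_integrand k \<phi> a has_integral I) {0<..<1}"
  unfolding has_contour_integral_linepath has_integral_Icc_iff_Ioo[symmetric]
    volterra_integrand_def by (simp add: linepath_def scaleR_conv_of_real)

lemma volterra_defined_iff:
  "volterra_defined k \<phi> a \<longleftrightarrow> volterra_integrand k \<phi> a integrable_on {0<..<1}"
  unfolding volterra_defined_def contour_integrable_on_def integrable_on_def
    has_contour_integral_volterra_iff ..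

lemma volterra_eq_integral:
  "volterra_defined k \<phi> a \<Longrightarrow> volterra k \<phi> a = integral {0<..<1} (volterra_integrand k \<phi> a)"
  unfolding volterra_def volterra_defined_iff
  by (rule contour_integral_unique) (auto simp: has_contour_integral_volterra_iff integrable_integral)

lemma volterra_diff:
  assumes "volterra_defined k \<phi> a" "volterra_defined k \<psi> a"
  shows "volterra k (\<lambda>z. \<phi> z - \<psi> z) a = volterra k \<phi> a - volterra k \<psi> a"
  using contour_integral_diff[OF assms[unfolded volterra_defined_def]]
  unfolding volterra_def by (simp add: right_diff_distrib)

section \<open>Weighted spaces of holomorphic functions\<close>

definition weight :: "real \<Rightarrow> real \<Rightarrow> complex \<Rightarrow> real" where
  "weight s L a = cmod a powr s * exp (L * cmod a)"

text \<open>The bound of \<open>HLinf\<close> with the weight multiplied out, in the form of the set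
  \<open>E\<close> of the fixed point lemma.\<close>

definition weighted_space :: "complex set \<Rightarrow> real \<Rightarrow> real \<Rightarrow> (complex \<Rightarrow> complex) set" where
  "weighted_space \<Omega> s L = {\<phi>. \<phi> holomorphic_on \<Omega> \<and> (\<exists>C. \<forall>a\<in>\<Omega>. cmod (\<phi> a) \<le> C * weight s L a)}"

lemma weight_nonneg [simp]: "0 \<le> weight s L a"
  unfolding weight_def by simp

lemma weight_pos [simp]: "a \<noteq> 0 \<Longrightarrow> 0 < weight s L a"
  unfolding weight_def by simp

lemma continuous_on_weight: "0 \<notin> S \<Longrightarrow> continuous_on S (weight s L)"
  unfolding weight_def by (intro continuous_intros) auto

text \<open>Splitting \<open>L * t\<close> as \<open>L - L * (1 - t)\<close> in the exponent
  isolates a decaying factor. This decay is what makes the Volterra operators small for large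
  \<open>L\<close>.\<close>

lemma weight_scale:
  assumes "0 < t"
  shows "weight s L (of_real t * a) = t powr s * exp (- L * (1 - t) * cmod a) * weight s L a"
proof -
  have "weight s L (of_real t * a) = t powr s * cmod a powr s * exp (- L * (1 - t) * cmod a + L * cmod a)"
    using assms unfolding weight_def by (simp add: norm_mult powr_mult algebra_simps)
  then show ?thesis unfolding weight_def exp_add by (simp add: mult_ac)
qed

text \<open>Away from 0 the weight is positive, so the supremum bound may be multiplied by
  it.\<close>

lemma HLinf_eq_weighted_space:
  assumes "0 \<notin> \<Omega>"
  shows "HLinf \<Omega> s L = weighted_space \<Omega> s L"
proof -
  have "cmod a powr (- s) * exp (- L * cmod a) * cmod (f a) \<le> C \<longleftrightarrow> cmod (f a) \<le> C * weight s L a"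
    if "a \<in> \<Omega>" for a C and f :: "complex \<Rightarrow> complex"
  proof -
    have "weight s L a > 0" using that assms by (intro weight_pos) auto
    moreover have "cmod a powr (- s) * exp (- L * cmod a) * cmod (f a) = cmod (f a) / weight s L a"
      unfolding weight_def by (simp add: powr_minus exp_minus field_simps)
    ultimately show ?thesis by (simp add: pos_divide_le_eq)
  qed
  then show ?thesis
    unfolding HLinf_def weighted_space_def bdd_above_def by auto
qed

text \<open>The exponential grows with its rate. This brings functions of different exponential type
  into one space.\<close>

lemma weighted_space_mono:
  assumes "L \<le> L'"
  shows "weighted_space \<Omega> s L \<subseteq> weighted_space \<Omega> s L'"
proof
  fix \<phi> assume \<phi>: "\<phi> \<in> weighted_space \<Omega> s L"
  then obtain C where C: "\<forall>a\<in>\<Omega>. cmod (\<phi> a) \<le> C * weight s L a" unfolding weighted_space_def by blast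
  \<comment> \<open>Nothing here forces \<open>C\<close> to be nonnegative, as \<Omega> may be
    empty, so the absolute value is taken.\<close>
  have "cmod (\<phi> a) \<le> \<bar>C\<bar> * weight s L' a" if "a \<in> \<Omega>" for a
  proof -
    have "weight s L a \<le> weight s L' a"
      unfolding weight_def using assms by (intro mult_left_mono) (auto intro: mult_right_mono)
    then have "C * weight s L a \<le> \<bar>C\<bar> * weight s L' a" by (intro mult_mono) auto
    then show ?thesis using C that by fastforce
  qed
  then show "\<phi> \<in> weighted_space \<Omega> s L'" using \<phi> unfolding weighted_space_def by blast
qed

lemma weighted_space_diff:
  assumes "\<phi> \<in> weighted_space \<Omega> s L" "\<psi> \<in> weighted_space \<Omega> s L"
  shows "(\<lambda>z. \<phi> z - \<psi> z) \<in> weighted_space \<Omega> s L"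
proof -
  obtain C D where "\<forall>a\<in>\<Omega>. cmod (\<phi> a) \<le> C * weight s L a" "\<forall>a\<in>\<Omega>. cmod (\<psi> a) \<le> D * weight s L a"
    using assms unfolding weighted_space_def by blast
  then have "\<forall>a\<in>\<Omega>. cmod (\<phi> a - \<psi> a) \<le> (C + D) * weight s L a"
    by (auto simp: distrib_right intro!: order_trans[OF norm_triangle_ineq4 add_mono])
  then show ?thesis using assms unfolding weighted_space_def by (auto intro: holomorphic_intros)
qed

section \<open>Volterra operators on weighted spaces\<close>

lemma has_integral_powr_Ioo:
  fixes s :: real
  assumes "s > -1"
  shows "((\<lambda>t. t powr s) has_integral 1 / (s + 1)) {0<..<1}"
  using has_integral_powr_from_0[OF assms, of 1] by (simp add: has_integral_Icc_iff_Ioo)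

text \<open>The bound \<open>s > -1\<close> makes \<open>t powr s\<close> integrable at \<open>0\<close>; in the application \<open>s = \<rho> - 1\<close>.\<close>

locale volterra_kernel =
  fixes \<Omega> :: "complex set" and k :: "complex \<Rightarrow> complex \<Rightarrow> complex" and s :: real
    and B :: "complex \<Rightarrow> real"
  assumes open_dom: "open \<Omega>" and zero_notin: "0 \<notin> \<Omega>" and star: "star_shaped_0 \<Omega>"
    and hol2: "holomorphic2_on (\<lambda>(a, a'). k a a') (\<Omega> \<times> \<Omega>)" and s: "s > -1"
    and B: "continuous_on \<Omega> B"
    and k_le: "\<And>a t. a \<in> \<Omega> \<Longrightarrow> 0 < t \<Longrightarrow> t < 1 \<Longrightarrow> cmod (k a (of_real t * a)) \<le> B a"
begin

lemma segment_in_dom: "a \<in> \<Omega> \<Longrightarrow> 0 < t \<Longrightarrow> t < 1 \<Longrightarrow> of_real t * a \<in> \<Omega>"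
  using star unfolding star_shaped_0_def by auto

text \<open>Comes from \<open>weight_scale\<close>, with the kernel and the exponential kept as they
  are, because the two kernels need different estimates for their product.\<close>

lemma integrand_le:
  assumes C: "\<forall>a\<in>\<Omega>. cmod (\<phi> a) \<le> C * weight s L a" and a: "a \<in> \<Omega>" and t: "0 < t" "t < 1"
  shows "cmod (volterra_integrand k \<phi> a t)
    \<le> C * weight s L a * (cmod (k a (of_real t * a)) * cmod a * exp (- L * (1 - t) * cmod a) * t powr s)"
proof -
  have "cmod (\<phi> (of_real t * a)) \<le> C * (t powr s * exp (- L * (1 - t) * cmod a) * weight s L a)"
    using C segment_in_dom[OF a t] weight_scale[OF t(1)] by metis
  then have "cmod (k a (of_real t * a)) * cmod a * cmod (\<phi> (of_real t * a))
     \<le> cmod (k a (of_real t * a)) * cmod a * (C * (t powr s * exp (- L * (1 - t) * cmod a) * weight s L a))"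
    by (intro mult_left_mono) auto
  then show ?thesis unfolding volterra_integrand_def by (simp add: norm_mult mult_ac)
qed

lemma coeff_nonneg:
  assumes "\<forall>a\<in>\<Omega>. cmod (\<phi> a) \<le> C * weight s L a" "a \<in> \<Omega>"
  shows "0 \<le> C"
proof -
  have "0 \<le> C * weight s L a" using assms norm_ge_zero order_trans by blast
  moreover have "0 < weight s L a" using assms(2) zero_notin by (intro weight_pos) auto
  ultimately show ?thesis by (simp add: zero_le_mult_iff)
qed

text \<open>A cruder majorant that separates the variables: continuous in \<open>a\<close> through
  \<open>B\<close>, and an integrable power of \<open>t\<close>. It serves both existence and
  holomorphy of the integral; \<open>0 \<le> L\<close> lets the exponential be dropped.\<close>

lemma integrand_le':
  assumes C: "\<forall>a\<in>\<Omega>. cmod (\<phi> a) \<le> C * weight s L a" and a: "a \<in> \<Omega>" and t: "0 < t" "t < 1" and L: "0 \<le> L"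
  shows "cmod (volterra_integrand k \<phi> a t) \<le> C * weight s L a * (B a * cmod a) * t powr s"
proof -
  have "0 \<le> B a" using k_le[OF a t] norm_ge_zero order_trans by blast
  then have "cmod (k a (of_real t * a)) * cmod a * exp (- L * (1 - t) * cmod a) * t powr s
      \<le> (B a * cmod a) * 1 * t powr s"
    using k_le[OF a t] L t by (intro mult_right_mono mult_mono) auto
  then have "C * weight s L a * (cmod (k a (of_real t * a)) * cmod a * exp (- L * (1 - t) * cmod a) * t powr s)
     \<le> C * weight s L a * ((B a * cmod a) * 1 * t powr s)"
    using coeff_nonneg[OF C a] by (intro mult_left_mono) auto
  then show ?thesis using integrand_le[OF C a t] by (simp add: mult_ac)
qed

text \<open>The integrand is continuous on the open interval, hence measurable, and dominated by a
  multiple of \<open>t powr s\<close>.\<close>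

lemma volterra_defined_weighted:
  assumes \<phi>: "\<phi> \<in> weighted_space \<Omega> s L" and L: "0 \<le> L" and a: "a \<in> \<Omega>"
  shows "volterra_defined k \<phi> a"
proof -
  obtain C where C: "\<forall>a\<in>\<Omega>. cmod (\<phi> a) \<le> C * weight s L a" using \<phi> unfolding weighted_space_def by blast
  show ?thesis
    unfolding volterra_defined_iff
  proof (rule measurable_bounded_by_integrable_imp_integrable)
    show "{0<..<1::real} \<in> sets lebesgue" by simp
    have "continuous_on \<Omega> \<phi>" using \<phi> holomorphic_on_imp_continuous_on unfolding weighted_space_def by blast
    then have "continuous_on {0<..<1} (\<lambda>t::real. \<phi> (of_real t * a))"
      by (rule continuous_on_compose2) (auto intro!: continuous_intros segment_in_dom a)
    moreover have "continuous_on {0<..<1} (\<lambda>t::real. (\<lambda>(a, a'). k a a') (a, of_real t * a))"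
      by (rule continuous_on_compose2[OF holomorphic2_on_imp_continuous_on[OF hol2]])
         (auto intro!: continuous_intros segment_in_dom a)
    ultimately have "continuous_on {0<..<1} (volterra_integrand k \<phi> a)"
      unfolding volterra_integrand_def by (auto intro!: continuous_intros)
    then show "volterra_integrand k \<phi> a \<in> borel_measurable (lebesgue_on {0<..<1})"
      by (rule continuous_imp_measurable_on_sets_lebesgue) simp
    show "(\<lambda>t. C * weight s L a * (B a * cmod a) * t powr s) integrable_on {0<..<1}"
      using has_integral_powr_Ioo[OF s] by (intro integrable_on_mult_right) blast
    show "cmod (volterra_integrand k \<phi> a t) \<le> C * weight s L a * (B a * cmod a) * t powr s"
      if "t \<in> {0<..<1}" for t
      using integrand_le'[OF C a _ _ L] that by simp
  qed
qed

text \<open>For fixed \<open>t\<close> the integrand is holomorphic in \<open>a\<close>. On a closed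
  disc the continuous factor \<open>?Q\<close> is at most some \<open>K\<close>, so
  \<open>K * t powr s\<close> dominates uniformly in \<open>a\<close>.\<close>

lemma volterra_holomorphic:
  assumes \<phi>: "\<phi> \<in> weighted_space \<Omega> s L" and L: "0 \<le> L"
  shows "volterra k \<phi> holomorphic_on \<Omega>"
proof -
  note def = volterra_defined_weighted[OF \<phi> L]
  obtain C where C: "\<forall>a\<in>\<Omega>. cmod (\<phi> a) \<le> C * weight s L a"
    and hol: "\<phi> holomorphic_on \<Omega>" using \<phi> unfolding weighted_space_def by blast
  let ?Q = "\<lambda>a. C * weight s L a * (B a * cmod a)"
  have "(\<lambda>a. integral {0<..<1} (volterra_integrand k \<phi> a)) holomorphic_on \<Omega>"
  proof (rule holomorphic_on_dominated_integral[OF open_dom])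
    fix t :: real assume t: "t \<in> {0<..<1}"
    have "(\<phi> \<circ> (\<lambda>z. of_real t * z)) holomorphic_on \<Omega>"
      by (rule holomorphic_on_compose_gen[OF _ hol])
         (use t segment_in_dom in \<open>auto intro!: holomorphic_intros\<close>)
    moreover have "(\<lambda>z. (\<lambda>(a, a'). k a a') (z, of_real t * z)) holomorphic_on \<Omega>"
      by (rule holomorphic2_on_compose[OF hol2]) (use t segment_in_dom in \<open>auto intro!: holomorphic_intros\<close>)
    ultimately show "(\<lambda>z. volterra_integrand k \<phi> z t) holomorphic_on \<Omega>"
      unfolding volterra_integrand_def by (auto intro!: holomorphic_intros simp: comp_def)
  next
    show "volterra_integrand k \<phi> z integrable_on {0<..<1}" if "z \<in> \<Omega>" for z
      using def[OF that] unfolding volterra_defined_iff .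
  next
    fix a assume "a \<in> \<Omega>"
    then obtain r where r: "r > 0" "cball a r \<subseteq> \<Omega>" using open_dom open_contains_cball by blast
    have "continuous_on (cball a r) ?Q"
      by (rule continuous_on_subset[OF _ r(2)])
         (intro continuous_intros continuous_on_weight zero_notin B)
    then have "compact (?Q ` cball a r)" by (rule compact_continuous_image) simp
    then obtain K where K: "\<And>z. z \<in> cball a r \<Longrightarrow> ?Q z \<le> K"
      using bounded_imp_bdd_above[OF compact_imp_bounded] unfolding bdd_above_def by (meson imageI)
    have "cmod (volterra_integrand k \<phi> z t) \<le> K * t powr s" if "z \<in> ball a r" "t \<in> {0<..<1}" for z t
    proof -
      have z: "z \<in> \<Omega>" "z \<in> cball a r" using that r by auto
      have "?Q z * t powr s \<le> K * t powr s" using K[OF z(2)] by (intro mult_right_mono) auto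
      moreover have "cmod (volterra_integrand k \<phi> z t) \<le> ?Q z * t powr s"
        using integrand_le'[OF C z(1) _ _ L] that by simp
      ultimately show ?thesis by (rule order_trans[rotated])
    qed
    moreover have "(\<lambda>t. K * t powr s) integrable_on {0<..<1}"
      using has_integral_powr_Ioo[OF s] by (intro integrable_on_mult_right) blast
    moreover have "ball a r \<subseteq> \<Omega>" using r by auto
    ultimately show "\<exists>r>0. \<exists>h. ball a r \<subseteq> \<Omega> \<and> h integrable_on {0<..<1} \<and>
        (\<forall>z\<in>ball a r. \<forall>t\<in>{0<..<1}. cmod (volterra_integrand k \<phi> z t) \<le> h t)"
      using r(1) by (intro exI[of _ r] exI[of _ "\<lambda>t. K * t powr s"]) auto
  qed
  then show ?thesis
    by (rule holomorphic_transform) (use def volterra_eq_integral in auto)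
qed

text \<open>Reduces a contraction estimate to one real integral: any majorant \<open>H\<close> of
  the kernel with its decay and power factors yields its integral \<open>I\<close> as contraction
  constant at the point \<open>a\<close>.\<close>

lemma volterra_norm_le:
  assumes \<phi>: "\<phi> \<in> weighted_space \<Omega> s L" and L: "0 \<le> L" and a: "a \<in> \<Omega>"
    and C: "\<forall>a\<in>\<Omega>. cmod (\<phi> a) \<le> C * weight s L a"
    and H: "(H has_integral I) {0<..<1}"
    and le: "\<And>t. 0 < t \<Longrightarrow> t < 1 \<Longrightarrow>
       cmod (k a (of_real t * a)) * cmod a * exp (- L * (1 - t) * cmod a) * t powr s \<le> H t"
  shows "cmod (volterra k \<phi> a) \<le> I * C * weight s L a"
proof -
  note def = volterra_defined_weighted[OF \<phi> L a]
  have HI: "((\<lambda>t. C * weight s L a * H t) has_integral C * weight s L a * I) {0<..<1}"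
    by (rule has_integral_mult_right[OF H])
  have "cmod (integral {0<..<1} (volterra_integrand k \<phi> a)) \<le> integral {0<..<1} (\<lambda>t. C * weight s L a * H t)"
  proof (rule integral_norm_bound_integral)
    show "volterra_integrand k \<phi> a integrable_on {0<..<1}" using def unfolding volterra_defined_iff .
    show "(\<lambda>t. C * weight s L a * H t) integrable_on {0<..<1}" using HI by blast
    fix t :: real assume t: "t \<in> {0<..<1}"
    have "C * weight s L a * (cmod (k a (of_real t * a)) * cmod a * exp (- L * (1 - t) * cmod a) * t powr s)
        \<le> C * weight s L a * H t"
      using le[of t] t coeff_nonneg[OF C a] by (intro mult_left_mono) auto
    then show "cmod (volterra_integrand k \<phi> a t) \<le> C * weight s L a * H t"
      using integrand_le[OF C a, of t] t by simp
  qed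
  then show ?thesis
    unfolding volterra_eq_integral[OF def] integral_unique[OF HI] by (simp add: mult_ac)
qed

end

section \<open>Contraction estimates for large exponential rates\<close>

text \<open>Raise \<open>y \<le> exp y\<close> at \<open>y = \<mu> * x / \<gamma>\<close> to the
  power \<gamma>.\<close>

lemma powr_times_exp_le:
  fixes x \<mu> \<gamma> :: real
  assumes "0 \<le> x" "0 < \<mu>" "0 < \<gamma>"
  shows "x powr \<gamma> * exp (- \<mu> * x) \<le> (\<gamma> / \<mu>) powr \<gamma>"
proof -
  have "\<mu> * x / \<gamma> \<le> exp (\<mu> * x / \<gamma>)" using exp_ge_add_one_self[of "\<mu> * x / \<gamma>"] by linarith
  then have "x \<le> \<gamma> / \<mu> * exp (\<mu> * x / \<gamma>)" using assms by (simp add: field_simps)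
  then have "x powr \<gamma> \<le> (\<gamma> / \<mu> * exp (\<mu> * x / \<gamma>)) powr \<gamma>"
    using assms by (intro powr_mono2) auto
  also have "\<dots> = (\<gamma> / \<mu>) powr \<gamma> * exp (\<mu> * x)"
    by (subst powr_mult) (use assms in \<open>simp_all add: exp_powr_real\<close>)
  finally have "x powr \<gamma> * exp (- (\<mu> * x)) \<le> (\<gamma> / \<mu>) powr \<gamma> * exp (\<mu> * x) * exp (- (\<mu> * x))"
    by (intro mult_right_mono) auto
  then show ?thesis by (simp add: mult.assoc flip: exp_add)
qed

text \<open>Since \<open>t < 1\<close> and \<open>d > 0\<close>, the integrand tends to 0 pointwise,
  and \<open>t powr s\<close> dominates it.\<close>

lemma integral_powr_exp_tendsto_0:
  fixes s d :: real
  assumes "s > -1" "d > 0"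
  shows "(\<lambda>n. integral {0<..<1} (\<lambda>t. t powr s * exp (- real n * ((1 - t) * d)))) \<longlonglongrightarrow> 0"
    and "(\<lambda>t. t powr s * exp (- real n * ((1 - t) * d))) integrable_on {0<..<1}"
proof -
  have le: "norm (t powr s * exp (- real n * ((1 - t) * d))) \<le> t powr s" if "t \<in> {0<..<1}" for n t
    using that assms by (simp add: mult_left_le)
  have int: "(\<lambda>t. t powr s * exp (- real n * ((1 - t) * d))) integrable_on {0<..<1}" for n
  proof (rule measurable_bounded_by_integrable_imp_integrable)
    show "(\<lambda>t. t powr s * exp (- real n * ((1 - t) * d))) \<in> borel_measurable (lebesgue_on {0<..<1})"
      by (rule continuous_imp_measurable_on_sets_lebesgue) (auto intro!: continuous_intros)
    show "(\<lambda>t. t powr s) integrable_on {0<..<1}" using has_integral_powr_Ioo[OF assms(1)] by blast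
  qed (use le in auto)
  have "(\<lambda>n. integral {0<..<1} (\<lambda>t. t powr s * exp (- real n * ((1 - t) * d)))) \<longlonglongrightarrow>
      integral {0<..<1::real} (\<lambda>t. 0)"
  proof (rule dominated_convergence(2)[OF int])
    show "(\<lambda>t. t powr s) integrable_on {0<..<1}" using has_integral_powr_Ioo[OF assms(1)] by blast
    fix t :: real assume t: "t \<in> {0<..<1}"
    have "(1 - t) * d > 0" using t assms by simp
    then have "(\<lambda>n. exp (- ((1 - t) * d)) ^ n) \<longlonglongrightarrow> 0" by (intro LIMSEQ_realpow_zero) auto
    moreover have "exp (- ((1 - t) * d)) ^ n = exp (- real n * ((1 - t) * d))" for n
      unfolding exp_of_nat_mult[symmetric] by simp
    ultimately have "(\<lambda>n. exp (- real n * ((1 - t) * d))) \<longlonglongrightarrow> 0" by (simp only:)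
    then have "(\<lambda>n. t powr s * exp (- real n * ((1 - t) * d))) \<longlonglongrightarrow> t powr s * 0"
      by (rule tendsto_mult_left)
    then show "(\<lambda>n. t powr s * exp (- real n * ((1 - t) * d))) \<longlonglongrightarrow> 0" by simp
  qed (use le in auto)
  then show "(\<lambda>n. integral {0<..<1} (\<lambda>t. t powr s * exp (- real n * ((1 - t) * d)))) \<longlonglongrightarrow> 0" by simp
  show "(\<lambda>t. t powr s * exp (- real n * ((1 - t) * d))) integrable_on {0<..<1}" by (rule int)
qed

context volterra_kernel
begin

text \<open>For \<open>cmod a < d\<close> the small kernel bound gives exactly
  \<open>\<sigma> / (s + 1)\<close>, the integral of \<open>\<sigma> * t powr s\<close>. For the
  other points the contribution can be pushed below any positive number, so in particular below the
  same constant, however large \<open>M\<close> is.\<close>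

lemma volterra_contraction_near_0:
  assumes M: "0 \<le> M" and d: "d > 0"
    and k_le: "\<And>a t. a \<in> \<Omega> \<Longrightarrow> 0 < t \<Longrightarrow> t < 1 \<Longrightarrow>
       cmod (k a (of_real t * a)) \<le> M / cmod a * exp (l * ((1 - t) * cmod a))"
    and k_small: "\<And>a t. a \<in> \<Omega> \<Longrightarrow> cmod a < d \<Longrightarrow> 0 < t \<Longrightarrow> t < 1 \<Longrightarrow>
       cmod (k a (of_real t * a)) \<le> \<sigma> / cmod a"
    and \<sigma>: "0 < \<sigma>"
  shows "\<exists>L0\<ge>0. \<forall>L\<ge>L0. \<forall>\<phi>\<in>weighted_space \<Omega> s L. \<forall>C. (\<forall>a\<in>\<Omega>. cmod (\<phi> a) \<le> C * weight s L a) \<longrightarrow>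
      (\<forall>a\<in>\<Omega>. cmod (volterra k \<phi> a) \<le> \<sigma> / (s + 1) * C * weight s L a)"
proof -
  define I where "I n = integral {0<..<1} (\<lambda>t. t powr s * exp (- real n * ((1 - t) * d)))" for n
  have "I \<longlonglongrightarrow> 0" unfolding I_def by (rule integral_powr_exp_tendsto_0[OF s d])
  then have "(\<lambda>n. M * I n) \<longlonglongrightarrow> 0" by (rule tendsto_mult_right_zero)
  moreover have "\<sigma> / (s + 1) > 0" using s \<sigma> by simp
  ultimately have "\<forall>\<^sub>F n in sequentially. M * I n < \<sigma> / (s + 1)" by (rule order_tendstoD(2))
  then obtain n where n: "M * I n < \<sigma> / (s + 1)" using eventually_happens by force
  have HI: "((\<lambda>t. M * (t powr s * exp (- real n * ((1 - t) * d)))) has_integral M * I n) {0<..<1}"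
    unfolding I_def by (intro has_integral_mult_right integrable_integral integral_powr_exp_tendsto_0 s d)
  have H\<sigma>: "((\<lambda>t. \<sigma> * t powr s) has_integral \<sigma> * (1 / (s + 1))) {0<..<1}"
    by (intro has_integral_mult_right has_integral_powr_Ioo s)
  \<comment> \<open>In the threshold \<open>n + l\<close>, the part \<open>l\<close> cancels the
    exponential growth of the kernel and \<open>n\<close> remains as decay rate; the maximum with 0
    provides \<open>0 \<le> L\<close>.\<close>
  have "cmod (volterra k \<phi> a) \<le> \<sigma> / (s + 1) * C * weight s L a"
    if L: "max 0 (real n + l) \<le> L" and \<phi>: "\<phi> \<in> weighted_space \<Omega> s L"
      and C: "\<forall>a\<in>\<Omega>. cmod (\<phi> a) \<le> C * weight s L a" and a: "a \<in> \<Omega>" for L \<phi> C a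
  proof -
    have L0: "0 \<le> L" using L by simp
    have a0: "cmod a > 0" using a zero_notin by auto
    show ?thesis
    proof (cases "cmod a < d")
      case True
      have "cmod (volterra k \<phi> a) \<le> \<sigma> * (1 / (s + 1)) * C * weight s L a"
      proof (rule volterra_norm_le[OF \<phi> L0 a C H\<sigma>])
        fix t :: real assume t: "0 < t" "t < 1"
        have "cmod (k a (of_real t * a)) * cmod a \<le> \<sigma>"
          using k_small[OF a True t] a0 by (simp add: field_simps)
        moreover have "exp (- L * (1 - t) * cmod a) \<le> 1" using t L0 by simp
        ultimately have "cmod (k a (of_real t * a)) * cmod a * exp (- L * (1 - t) * cmod a) \<le> \<sigma> * 1"
          using \<sigma> by (intro mult_mono) auto
        then show "cmod (k a (of_real t * a)) * cmod a * exp (- L * (1 - t) * cmod a) * t powr s \<le> \<sigma> * t powr s"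
          by (intro mult_right_mono) auto
      qed
      then show ?thesis by simp
    next
      case False
      have "cmod (volterra k \<phi> a) \<le> M * I n * C * weight s L a"
      proof (rule volterra_norm_le[OF \<phi> L0 a C HI])
        fix t :: real assume t: "0 < t" "t < 1"
        let ?x = "(1 - t) * cmod a"
        have "l * ?x + - L * ?x \<le> - real n * ?x"
        proof -
          have "(real n + l - L) * ?x \<le> 0" using L t by (intro mult_nonpos_nonneg) auto
          then show ?thesis by (simp add: algebra_simps)
        qed
        \<comment> \<open>Here \<open>cmod a \<ge> d\<close> replaces \<open>cmod a\<close> by
          \<open>d\<close>, so the majorant no longer depends on \<open>a\<close>.\<close>
        also have "\<dots> \<le> - real n * ((1 - t) * d)"
          using False t by (intro mult_left_mono_neg mult_left_mono) auto
        finally have e: "exp (l * ?x) * exp (- L * ?x) \<le> exp (- real n * ((1 - t) * d))"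
          by (simp flip: exp_add)
        have "cmod (k a (of_real t * a)) * cmod a \<le> M * exp (l * ?x)"
          using k_le[OF a t] a0 by (simp add: field_simps)
        then have "cmod (k a (of_real t * a)) * cmod a * exp (- L * ?x) \<le> M * exp (l * ?x) * exp (- L * ?x)"
          by (intro mult_right_mono) auto
        also have "\<dots> \<le> M * exp (- real n * ((1 - t) * d))"
          using mult_left_mono[OF e M] by (simp add: mult.assoc)
        finally have "cmod (k a (of_real t * a)) * cmod a * exp (- L * ?x) * t powr s
            \<le> M * exp (- real n * ((1 - t) * d)) * t powr s"
          by (intro mult_right_mono) auto
        then show "cmod (k a (of_real t * a)) * cmod a * exp (- L * (1 - t) * cmod a) * t powr s
            \<le> M * (t powr s * exp (- real n * ((1 - t) * d)))"
          by (simp add: mult_ac)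
      qed
      also have "\<dots> \<le> \<sigma> / (s + 1) * C * weight s L a"
        using n coeff_nonneg[OF C a] by (intro mult_right_mono) auto
      finally show ?thesis .
    qed
  qed
  then show ?thesis by (intro exI[of _ "max 0 (real n + l)"]) auto
qed

text \<open>With \<open>x = (1 - t) * cmod a\<close>, surplus decay \<open>exp (- \<mu> * x)\<close>
  absorbs the diagonal factor \<open>x powr \<gamma>\<close> uniformly in \<open>a\<close> and
  \<open>t\<close>, leaving a constant that tends to 0 as \<mu> grows. No case distinction on the
  size of \<open>a\<close> is required.\<close>

lemma volterra_contraction_vanishing_diagonal:
  assumes M: "0 \<le> M" and \<gamma>: "0 < \<gamma>" and \<epsilon>: "0 < \<epsilon>"
    and k_le: "\<And>a t. a \<in> \<Omega> \<Longrightarrow> 0 < t \<Longrightarrow> t < 1 \<Longrightarrow>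
       cmod (k a (of_real t * a)) \<le> M * (((1 - t) * cmod a) powr \<gamma> / cmod a) * exp (l * ((1 - t) * cmod a))"
  shows "\<exists>L0\<ge>0. \<forall>L\<ge>L0. \<forall>\<phi>\<in>weighted_space \<Omega> s L. \<forall>C. (\<forall>a\<in>\<Omega>. cmod (\<phi> a) \<le> C * weight s L a) \<longrightarrow>
      (\<forall>a\<in>\<Omega>. cmod (volterra k \<phi> a) \<le> \<epsilon> * C * weight s L a)"
proof -
  have "((\<lambda>\<mu>. M / (s + 1) * (\<gamma> / \<mu>) powr \<gamma>) \<longlongrightarrow> M / (s + 1) * 0) at_top"
  proof (intro tendsto_mult_left)
    have "((\<lambda>\<mu>. (\<gamma> / \<mu>) powr \<gamma>) \<longlongrightarrow> 0 powr \<gamma>) at_top"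
    proof (rule tendsto_powr2)
      show "((\<lambda>\<mu>. \<gamma> / \<mu>) \<longlongrightarrow> 0) at_top"
        by (intro tendsto_divide_0[OF tendsto_const] filterlim_at_top_imp_at_infinity filterlim_ident)
      show "\<forall>\<^sub>F \<mu> in at_top. 0 \<le> \<gamma> / \<mu>"
        using eventually_gt_at_top[of 0] by eventually_elim (use \<gamma> in simp)
    qed (use \<gamma> in auto)
    then show "((\<lambda>\<mu>. (\<gamma> / \<mu>) powr \<gamma>) \<longlongrightarrow> 0) at_top" using \<gamma> by simp
  qed
  then have "((\<lambda>\<mu>. M / (s + 1) * (\<gamma> / \<mu>) powr \<gamma>) \<longlongrightarrow> 0) at_top" by simp
  \<comment> \<open>\<mu> is the excess of \<open>L\<close> over the growth rate \<open>l\<close>;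
    it is chosen so that the resulting bound falls below \<epsilon>.\<close>
  from eventually_conj[OF order_tendstoD(2)[OF this \<epsilon>] eventually_gt_at_top[of 0]]
  obtain \<mu> where \<mu>: "M / (s + 1) * (\<gamma> / \<mu>) powr \<gamma> < \<epsilon>" "\<mu> > 0"
    using eventually_happens by force
  define \<delta> where "\<delta> = M * (\<gamma> / \<mu>) powr \<gamma>"
  have HI: "((\<lambda>t. \<delta> * t powr s) has_integral \<delta> * (1 / (s + 1))) {0<..<1}"
    by (intro has_integral_mult_right has_integral_powr_Ioo s)
  have "cmod (volterra k \<phi> a) \<le> \<epsilon> * C * weight s L a"
    if L: "max 0 (\<mu> + l) \<le> L" and \<phi>: "\<phi> \<in> weighted_space \<Omega> s L"
      and C: "\<forall>a\<in>\<Omega>. cmod (\<phi> a) \<le> C * weight s L a" and a: "a \<in> \<Omega>" for L \<phi> C a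
  proof -
    have L0: "0 \<le> L" using L by simp
    have a0: "cmod a > 0" using a zero_notin by auto
    have "cmod (volterra k \<phi> a) \<le> \<delta> * (1 / (s + 1)) * C * weight s L a"
    proof (rule volterra_norm_le[OF \<phi> L0 a C HI])
      fix t :: real assume t: "0 < t" "t < 1"
      let ?x = "(1 - t) * cmod a"
      have x: "0 \<le> ?x" using t by simp
      have "l * ?x + - L * ?x \<le> - \<mu> * ?x"
      proof -
        have "(\<mu> + l - L) * ?x \<le> 0" using L x by (intro mult_nonpos_nonneg) auto
        then show ?thesis by (simp add: algebra_simps)
      qed
      then have e: "exp (l * ?x) * exp (- L * ?x) \<le> exp (- \<mu> * ?x)" by (simp flip: exp_add)
      have "cmod (k a (of_real t * a)) * cmod a \<le> M * ?x powr \<gamma> * exp (l * ?x)"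
        using k_le[OF a t] a0 by (simp add: field_simps)
      then have "cmod (k a (of_real t * a)) * cmod a * exp (- L * ?x)
          \<le> M * ?x powr \<gamma> * exp (l * ?x) * exp (- L * ?x)"
        by (intro mult_right_mono) auto
      also have "\<dots> \<le> M * ?x powr \<gamma> * exp (- \<mu> * ?x)"
        using mult_left_mono[OF e, of "M * ?x powr \<gamma>"] M by (simp add: mult.assoc)
      also have "\<dots> \<le> \<delta>"
        unfolding \<delta>_def using mult_left_mono[OF powr_times_exp_le[OF x \<mu>(2) \<gamma>] M] by (simp add: mult.assoc)
      finally have "cmod (k a (of_real t * a)) * cmod a * exp (- L * ?x) * t powr s \<le> \<delta> * t powr s"
        by (intro mult_right_mono) auto
      then show "cmod (k a (of_real t * a)) * cmod a * exp (- L * (1 - t) * cmod a) * t powr s \<le> \<delta> * t powr s"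
        by (simp add: mult.assoc)
    qed
    also have "\<dots> \<le> \<epsilon> * C * weight s L a"
      using \<mu> coeff_nonneg[OF C a] unfolding \<delta>_def by (intro mult_right_mono) auto
    finally show ?thesis .
  qed
  then show ?thesis by (intro exI[of _ "max 0 (\<mu> + l)"]) auto
qed

end

section \<open>Existence and uniqueness for the inhomogeneous equation\<close>

theorem lemma1p8:
  fixes \<Omega> :: "complex set"
    and p q g :: "complex \<Rightarrow> complex"
    and kstar :: "complex \<Rightarrow> complex \<Rightarrow> complex"
    and \<tau> \<gamma> lambda\<^sub>\<Delta> M \<rho> :: real
  assumes "open \<Omega>" and "simply_connected \<Omega>" and "0 \<notin> \<Omega>" and "0 \<in> closure \<Omega>"
    and "star_shaped_0 \<Omega>"
    and "p holomorphic_on \<Omega>" and "q holomorphic_on \<Omega>"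
    and "holomorphic2_on (\<lambda>(a, a'). kernel0 p q a a') (\<Omega> \<times> \<Omega>)"
    and "holomorphic2_on (\<lambda>(a, a'). kstar a a') (\<Omega> \<times> \<Omega>)"
    and "\<tau> > 0" and "\<gamma> > 0"
    and "\<exists>U. open U \<and> 0 \<in> U \<and>
           bounded ((\<lambda>a. kernel0 p q a a - of_real \<tau> / a) ` (U \<inter> \<Omega>))"
    and "\<And>\<sigma>::real. \<sigma> > \<tau> \<Longrightarrow>
           \<exists>U. open U \<and> (0, 0) \<in> U \<and>
             (\<forall>(a, a')\<in>U \<inter> (\<Omega> \<times> \<Omega>). cmod (kernel0 p q a a') < \<sigma> / cmod a)"
    and "\<And>a a'. a \<in> \<Omega> \<Longrightarrow> a' \<in> \<Omega> \<Longrightarrow>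
           cmod (kernel0 p q a a') \<le> M / cmod a * exp (lambda\<^sub>\<Delta> * cmod (a - a'))"
    and "\<And>a a'. a \<in> \<Omega> \<Longrightarrow> a' \<in> \<Omega> \<Longrightarrow>
           cmod (kstar a a') \<le> M * (cmod (a - a') powr \<gamma> / cmod a) * exp (lambda\<^sub>\<Delta> * cmod (a - a'))"
    and "\<rho> > \<tau>" and "g \<in> HLinf_bullet \<Omega> (\<rho> - 1)"
  shows "\<exists>f\<in>HLinf_bullet \<Omega> (\<rho> - 1).
           volterra_solution \<Omega> (kernel0 p q) kstar g f \<and>
           (\<forall>h\<in>HLinf_bullet \<Omega> (\<rho> - 1).
              volterra_solution \<Omega> (kernel0 p q) kstar g h \<longrightarrow> (\<forall>a\<in>\<Omega>. h a = f a))"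
proof -
  let ?k = "kernel0 p q"
  let ?s = "\<rho> - 1"
  let ?W = "weighted_space \<Omega> ?s"
  note zero = \<open>0 \<notin> \<Omega>\<close> and star = \<open>star_shaped_0 \<Omega>\<close>
  have "\<rho> > 0" using \<open>\<tau> > 0\<close> \<open>\<rho> > \<tau>\<close> by simp
  have nz: "cmod a > 0" if "a \<in> \<Omega>" for a using that zero by auto
  have seg: "of_real t * a \<in> \<Omega>" if "a \<in> \<Omega>" "0 < t" "t < 1" for a and t :: real
    using star that unfolding star_shaped_0_def by auto
  have dist_seg: "cmod (a - of_real t * a) = (1 - t) * cmod a" if "t < 1" for a and t :: real
  proof -
    have "a - of_real t * a = of_real (1 - t) * a" by (simp add: algebra_simps)
    then show ?thesis using that by (simp only: norm_mult norm_of_real)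
  qed
  \<comment> \<open>\<Omega> is nonempty because 0 lies in its closure; the kernel bound at a
    diagonal point then gives the sign of \<open>M\<close>.\<close>
  have M: "0 \<le> M"
  proof -
    obtain a where a: "a \<in> \<Omega>" using \<open>0 \<in> closure \<Omega>\<close> by fastforce
    have "0 \<le> M / cmod a * exp (lambda\<^sub>\<Delta> * cmod (a - a))"
      using assms(14)[OF a a] norm_ge_zero order_trans by blast
    then show ?thesis using nz[OF a] by (simp add: zero_le_divide_iff)
  qed
  have k0: "cmod (?k a (of_real t * a)) \<le> M / cmod a * exp (lambda\<^sub>\<Delta> * ((1 - t) * cmod a))"
    if "a \<in> \<Omega>" "0 < t" "t < 1" for a t
    using assms(14)[OF that(1) seg[OF that]] by (simp only: dist_seg[OF that(3)])
  have ks: "cmod (kstar a (of_real t * a))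
      \<le> M * (((1 - t) * cmod a) powr \<gamma> / cmod a) * exp (lambda\<^sub>\<Delta> * ((1 - t) * cmod a))"
    if "a \<in> \<Omega>" "0 < t" "t < 1" for a t
    using assms(15)[OF that(1) seg[OF that]] by (simp only: dist_seg[OF that(3)])
  \<comment> \<open>Discarding \<open>t\<close> leaves a continuous function of \<open>a\<close>
    alone, as the locale parameter \<open>B\<close> must be. The absolute value covers both signs of
    \<open>lambda\<^sub>\<Delta>\<close>.\<close>
  have exp_seg: "exp (lambda\<^sub>\<Delta> * ((1 - t) * cmod a)) \<le> exp (\<bar>lambda\<^sub>\<Delta>\<bar> * cmod a)"
    if "0 < t" "t < 1" for a t
  proof -
    have "lambda\<^sub>\<Delta> * ((1 - t) * cmod a) \<le> \<bar>lambda\<^sub>\<Delta>\<bar> * (1 * cmod a)"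
      using that by (intro mult_mono mult_right_mono) auto
    then show ?thesis by simp
  qed
  interpret K0: volterra_kernel \<Omega> ?k ?s "\<lambda>a. M / cmod a * exp (\<bar>lambda\<^sub>\<Delta>\<bar> * cmod a)"
  proof
    fix a t assume at: "a \<in> \<Omega>" "0 < t" "t < (1::real)"
    have "M / cmod a * exp (lambda\<^sub>\<Delta> * ((1 - t) * cmod a)) \<le> M / cmod a * exp (\<bar>lambda\<^sub>\<Delta>\<bar> * cmod a)"
      using M exp_seg[OF at(2,3)] by (intro mult_left_mono) auto
    then show "cmod (?k a (of_real t * a)) \<le> M / cmod a * exp (\<bar>lambda\<^sub>\<Delta>\<bar> * cmod a)"
      using k0[OF at] by simp
  next
    show "continuous_on \<Omega> (\<lambda>a. M / cmod a * exp (\<bar>lambda\<^sub>\<Delta>\<bar> * cmod a))"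
      using zero by (intro continuous_intros) auto
  qed (use assms \<open>\<rho> > 0\<close> in simp_all)
  interpret Ks: volterra_kernel \<Omega> kstar ?s
    "\<lambda>a. M * (cmod a powr \<gamma> / cmod a) * exp (\<bar>lambda\<^sub>\<Delta>\<bar> * cmod a)"
  proof
    fix a t assume at: "a \<in> \<Omega>" "0 < t" "t < (1::real)"
    have "((1 - t) * cmod a) powr \<gamma> \<le> (1 * cmod a) powr \<gamma>"
      using at \<open>\<gamma> > 0\<close> by (intro powr_mono2 mult_right_mono) auto
    then have "M * (((1 - t) * cmod a) powr \<gamma> / cmod a) * exp (lambda\<^sub>\<Delta> * ((1 - t) * cmod a))
        \<le> M * (cmod a powr \<gamma> / cmod a) * exp (\<bar>lambda\<^sub>\<Delta>\<bar> * cmod a)"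
      using M exp_seg[OF at(2,3)] by (intro mult_mono mult_left_mono divide_right_mono) auto
    then show "cmod (kstar a (of_real t * a)) \<le> M * (cmod a powr \<gamma> / cmod a) * exp (\<bar>lambda\<^sub>\<Delta>\<bar> * cmod a)"
      using ks[OF at] by simp
  next
    show "continuous_on \<Omega> (\<lambda>a. M * (cmod a powr \<gamma> / cmod a) * exp (\<bar>lambda\<^sub>\<Delta>\<bar> * cmod a))"
      using zero by (intro continuous_intros) auto
  qed (use assms \<open>\<rho> > 0\<close> in simp_all)
  \<comment> \<open>The midpoint: above \<tau>, so the local kernel bound is available, and below
    \<rho>, so \<open>\<sigma> / \<rho> < 1\<close>.\<close>
  define \<sigma> where "\<sigma> = (\<tau> + \<rho>) / 2"
  have \<sigma>: "\<tau> < \<sigma>" "\<sigma> < \<rho>" "0 < \<sigma>" using \<open>\<tau> > 0\<close> \<open>\<rho> > \<tau>\<close> unfolding \<sigma>_def by auto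
  obtain U where U: "open U" "(0, 0) \<in> U"
    "\<forall>(a, a')\<in>U \<inter> (\<Omega> \<times> \<Omega>). cmod (?k a a') < \<sigma> / cmod a"
    using assms(13)[OF \<sigma>(1)] by blast
  \<comment> \<open>A neighborhood of the origin in the product contains the square of a ball. As
    \<open>cmod (t * a) \<le> cmod a\<close> on the segment, the single condition
    \<open>cmod a < d\<close> suffices.\<close>
  obtain A B where AB: "open A" "open B" "(0, 0) \<in> A \<times> B" "A \<times> B \<subseteq> U"
    by (rule open_prod_elim[OF U(1,2)])
  then have "open (A \<inter> B)" "0 \<in> A \<inter> B" by auto
  then obtain d where d: "d > 0" "ball 0 d \<subseteq> A \<inter> B" using open_contains_ball by blast
  have small: "cmod (?k a (of_real t * a)) \<le> \<sigma> / cmod a"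
    if "a \<in> \<Omega>" "cmod a < d" "0 < t" "t < 1" for a t
  proof -
    have "cmod (of_real t * a) \<le> 1 * cmod a"
      unfolding norm_mult using that by (intro mult_right_mono) auto
    then have "a \<in> ball 0 d" "of_real t * a \<in> ball 0 d" using that by auto
    then have "(a, of_real t * a) \<in> U \<inter> (\<Omega> \<times> \<Omega>)" using d AB(4) seg[of a t] that by blast
    from bspec[OF U(3) this] show ?thesis by simp
  qed
  \<comment> \<open>Half of the gap left by \<open>\<sigma> / \<rho>\<close>, so that both
    contributions together stay below 1. The first one is \<open>\<sigma> / (s + 1)\<close> with
    \<open>s = \<rho> - 1\<close>.\<close>
  define \<epsilon> where "\<epsilon> = (1 - \<sigma> / \<rho>) / 2"
  have \<epsilon>: "0 < \<epsilon>" "\<sigma> / \<rho> + \<epsilon> < 1" using \<sigma> \<open>\<rho> > 0\<close> unfolding \<epsilon>_def by (auto simp: field_simps)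
  obtain L0 where L0: "0 \<le> L0" "\<And>L \<phi> C a. L0 \<le> L \<Longrightarrow> \<phi> \<in> ?W L \<Longrightarrow>
      \<forall>a\<in>\<Omega>. cmod (\<phi> a) \<le> C * weight ?s L a \<Longrightarrow> a \<in> \<Omega> \<Longrightarrow>
      cmod (volterra ?k \<phi> a) \<le> \<sigma> / \<rho> * C * weight ?s L a"
    using K0.volterra_contraction_near_0[OF M d(1) k0 small \<sigma>(3)] by auto
  obtain L1 where L1: "0 \<le> L1" "\<And>L \<phi> C a. L1 \<le> L \<Longrightarrow> \<phi> \<in> ?W L \<Longrightarrow>
      \<forall>a\<in>\<Omega>. cmod (\<phi> a) \<le> C * weight ?s L a \<Longrightarrow> a \<in> \<Omega> \<Longrightarrow>
      cmod (volterra kstar \<phi> a) \<le> \<epsilon> * C * weight ?s L a"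
    using Ks.volterra_contraction_vanishing_diagonal[OF M \<open>\<gamma> > 0\<close> \<epsilon>(1) ks] by auto
  define \<theta> where "\<theta> = \<sigma> / \<rho> + \<epsilon>"
  have \<theta>: "0 \<le> \<theta>" "\<theta> < 1" using \<epsilon> \<sigma> \<open>\<rho> > 0\<close> unfolding \<theta>_def by auto
  define V where "V \<phi> a = volterra ?k \<phi> a + volterra kstar \<phi> a" for \<phi> a
  have V_le: "cmod (V \<phi> a) \<le> \<theta> * C * weight ?s L a"
    if "max L0 L1 \<le> L" "\<phi> \<in> ?W L" "\<forall>a\<in>\<Omega>. cmod (\<phi> a) \<le> C * weight ?s L a" "a \<in> \<Omega>" for L \<phi> C a
  proof -
    have "cmod (V \<phi> a) \<le> \<sigma> / \<rho> * C * weight ?s L a + \<epsilon> * C * weight ?s L a"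
      unfolding V_def by (rule norm_triangle_mono[OF L0(2) L1(2)]) (use that in auto)
    then show ?thesis unfolding \<theta>_def by (simp add: distrib_right)
  qed
  have V_diff: "V (\<lambda>z. \<phi> z - \<psi> z) a = V \<phi> a - V \<psi> a"
    if "0 \<le> L" "\<phi> \<in> ?W L" "\<psi> \<in> ?W L" "a \<in> \<Omega>" for L \<phi> \<psi> a
    unfolding V_def using that K0.volterra_defined_weighted Ks.volterra_defined_weighted
    by (simp add: volterra_diff)
  have bullet: "f \<in> HLinf_bullet \<Omega> ?s \<longleftrightarrow> (\<exists>L. f \<in> ?W L)" for f
    unfolding HLinf_bullet_def HLinf_eq_weighted_space[OF zero] by auto
  obtain Lg where Lg: "g \<in> ?W Lg" using \<open>g \<in> HLinf_bullet \<Omega> ?s\<close> bullet by blast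
  \<comment> \<open>Large enough for the space to contain \<open>g\<close> and for both kernel
    estimates to hold.\<close>
  define L where "L = max Lg (max L0 L1)"
  have L: "max L0 L1 \<le> L" "0 \<le> L" "g \<in> ?W L"
    using L0(1) Lg weighted_space_mono[of Lg L] unfolding L_def by auto
  \<comment> \<open>Unfolding exposes the set \<open>E\<close> of the fixed point lemma, with
    \<open>weight ?s L\<close> as \<open>w\<close>.\<close>
  have "\<exists>f\<in>?W L. \<forall>a\<in>\<Omega>. f a = V f a + g a"
    unfolding weighted_space_def
  proof (rule contraction_fixpoint_holomorphic[where \<theta> = \<theta>]; (fold weighted_space_def)?)
    show "V \<phi> holomorphic_on \<Omega>" if "\<phi> \<in> ?W L" for \<phi>
      unfolding V_def[abs_def]
      by (intro holomorphic_intros K0.volterra_holomorphic[OF that L(2)] Ks.volterra_holomorphic[OF that L(2)])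
    show "V (\<lambda>z. \<phi> z - \<psi> z) a = V \<phi> a - V \<psi> a"
      if "\<phi> \<in> ?W L" "\<psi> \<in> ?W L" "a \<in> \<Omega>" for \<phi> \<psi> a
      by (rule V_diff[OF L(2) that])
    show "cmod (V \<phi> a) \<le> \<theta> * C * weight ?s L a"
      if "\<phi> \<in> ?W L" "\<forall>a\<in>\<Omega>. cmod (\<phi> a) \<le> C * weight ?s L a" "a \<in> \<Omega>" for \<phi> C a
      by (rule V_le[OF L(1) that])
  qed (use L \<theta> zero \<open>open \<Omega>\<close> in \<open>auto intro: continuous_on_weight\<close>)
  then obtain f where f: "f \<in> ?W L" "\<And>a. a \<in> \<Omega> \<Longrightarrow> f a = V f a + g a" by blast
  show ?thesis
  proof (intro bexI conjI ballI impI)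
    show "f \<in> HLinf_bullet \<Omega> ?s" using f(1) bullet by blast
    show "volterra_solution \<Omega> ?k kstar g f"
      unfolding volterra_solution_def
      using K0.volterra_defined_weighted[OF f(1) L(2)] Ks.volterra_defined_weighted[OF f(1) L(2)]
        f(2) by (simp add: V_def)
    fix h a assume h: "h \<in> HLinf_bullet \<Omega> ?s" "volterra_solution \<Omega> ?k kstar g h" and a: "a \<in> \<Omega>"
    obtain Lh where Lh: "h \<in> ?W Lh" using h bullet by blast
    \<comment> \<open>\<open>h\<close> may have larger exponential type than \<open>f\<close>. The
      constant \<theta> is the same for every rate from \<open>max L0 L1\<close> on, so both can be
      compared at a common larger rate.\<close>
    define L' where "L' = max Lh L"
    have L': "max L0 L1 \<le> L'" "0 \<le> L'" using L unfolding L'_def by auto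
    have fh: "f \<in> ?W L'" "h \<in> ?W L'"
      using f(1) Lh weighted_space_mono[of L L' \<Omega> ?s] weighted_space_mono[of Lh L' \<Omega> ?s]
      unfolding L'_def by auto
    let ?u = "\<lambda>z. h z - f z"
    have u: "?u \<in> ?W L'" by (rule weighted_space_diff[OF fh(2,1)])
    \<comment> \<open>\<open>g\<close> cancels, so the difference is fixed by \<open>V\<close>; each
      application of \<open>V_le\<close> then improves its bound by a factor \<theta>.\<close>
    have fix_u: "?u z = V ?u z" if "z \<in> \<Omega>" for z
      using h(2) f(2)[OF that] that V_diff[OF L'(2) fh(2,1) that]
      unfolding volterra_solution_def by (simp add: V_def)
    obtain C where C: "\<forall>a\<in>\<Omega>. cmod (?u a) \<le> C * weight ?s L' a"
      using u unfolding weighted_space_def by blast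
    have "\<forall>a\<in>\<Omega>. cmod (?u a) \<le> \<theta> ^ n * C * weight ?s L' a" for n
    proof (induction n)
      case 0 then show ?case using C by simp
    next
      case (Suc n)
      show ?case
      proof
        fix z assume z: "z \<in> \<Omega>"
        show "cmod (?u z) \<le> \<theta> ^ Suc n * C * weight ?s L' z"
          using V_le[OF L'(1) u Suc z] fix_u[OF z] by (simp add: mult.assoc)
      qed
    qed
    then have "cmod (?u a) \<le> \<theta> ^ n * (C * weight ?s L' a)" for n using a by (simp add: mult.assoc)
    then have "\<exists>N. \<forall>n\<ge>N. cmod (?u a) \<le> \<theta> ^ n * (C * weight ?s L' a)" by (intro exI allI impI)
    with tendsto_mult_left_zero[OF LIMSEQ_realpow_zero[OF \<theta>]] have "cmod (?u a) \<le> 0"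
      by (rule LIMSEQ_le_const)
    then show "h a = f a" by simp
  qed
qed

end
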